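(* Let $v$ and $q$ be positive integers, $v$ not a square. Let $q_0$ be the smallest (positive) divisor of $q$ such that there is a pair $(r,c)\in\mathbb{Z}^2$ with $r^2-c^2v=\pm1$ (i.e. $r^2-c^2v\in\{1,-1\}$) and $(c,q^2)=qq_0$. Then the numbers $x=m/q+\sqrt v$, where $m$ is an integer with $(m,q)=1$ and $0\le m\le q-1$, belong to exactly $\varphi(q_0)$ equivalence classes with respect to $\sim$, each of which contains exactly $\varphi(q)/\varphi(q_0)$ of these numbers $x$.
   Context: $(a,b)$ denotes the (positive) greatest common divisor of the integers $a,b$; in particular $(0,b)=|b|$. $\varphi$ is Euler's totient function. Two real quadratic irrationals $x,y$ are called equivalent, written $x\sim y$, if their regular continued fraction expansions can be written with the same period, i.e. $x=[a_0,\ldots,a_{j-1},[b_1,\ldots,b_k]]$ and $y=[c_0,\ldots,c_{l-1},[b_1,\ldots,b_k]]$, where the inner bracket $[b_1,\ldots,b_k]$ is the common period, repeated indefinitely, and the pre-periods may be empty. By a classical theorem of Serret, $x\sim y$ is the same as: there are $a,b,c,d\in\mathbb{Z}$ with $ad-bc=\pm1$ and $y=\frac{ax+b}{cx+d}$. *)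

theory Defs
  imports "HOL-Number_Theory.Number_Theory" "HOL-Library.Stream" Complex_Main
begin

definition quadratic_irrational :: "real \<Rightarrow> bool" where
  "quadratic_irrational x \<longleftrightarrow> x \<notin> \<rat> \<and>
     (\<exists>a b c :: int. a \<noteq> 0 \<and> of_int a * x\<^sup>2 + of_int b * x + of_int c = 0)"

(* The complete quotients are x, 1 / frac x, ...; the partial quotients are their floors.
   Only meaningful for irrational x: for rational x a division by zero (= 0) occurs. *)
definition cf_expansion :: "real \<Rightarrow> int stream" where
  "cf_expansion x = smap floor (siterate (\<lambda>t. 1 / frac t) x)"

definition cf_equiv :: "(real \<times> real) set" where
  "cf_equiv = {(x, y). quadratic_irrational x \<and> quadratic_irrational y \<and>
     (\<exists>as bs cs. bs \<noteq> [] \<and>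
        cf_expansion x = as @- cycle bs \<and> cf_expansion y = cs @- cycle bs)}"

definition admissible_divisor :: "nat \<Rightarrow> nat \<Rightarrow> nat \<Rightarrow> bool" where
  "admissible_divisor v q d \<longleftrightarrow> 0 < d \<and> d dvd q \<and>
     (\<exists>r c :: int. r\<^sup>2 - c\<^sup>2 * int v \<in> {1, -1} \<and> gcd c ((int q)\<^sup>2) = int q * int d)"

(* The pair (r, c) = (1, 0) shows that the least admissible divisor exists. *)
lemma admissible_divisor_self: "0 < q \<Longrightarrow> admissible_divisor v q q"
  unfolding admissible_divisor_def
  by (intro conjI exI[of _ "1 :: int"] exI[of _ "0 :: int"]) (auto simp: power2_eq_square)

definition least_divisor :: "nat \<Rightarrow> nat \<Rightarrow> nat" where
  "least_divisor v q = (LEAST d. admissible_divisor v q d)"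

definition shifted_roots :: "nat \<Rightarrow> nat \<Rightarrow> real set" where
  "shifted_roots v q =
     {of_int m / of_nat q + sqrt (of_nat v) | m :: int.
        gcd m (int q) = 1 \<and> 0 \<le> m \<and> m \<le> int q - 1}"

end

theory Submission
  imports Defs
begin

text \<open>
  By Serret's theorem two irrational numbers have a common continued fraction tail if and only if
  they are related by a unimodular integral map (\<open>same_tail_iff_unimodular_related\<close>). By Lagrange's
  theorem (\<open>quadratic_irrational_periodic\<close>) the tails of quadratic irrationals are periodic, so that
  for them a common tail is the same as a common period (\<open>cf_equiv_iff_same_tail\<close>).

  Write \<open>x = m/q + sqrt v\<close> and \<open>y = n/q + sqrt v\<close> with \<open>m\<close> and \<open>n\<close> prime to \<open>q\<close>. If
  \<open>y = (a x + b) / (c x + d)\<close> with determinant \<open>\<plusminus>1\<close>, then \<open>c x + d\<close> is an integral unit of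
  norm \<open>\<plusminus>1\<close> of the form \<open>r + q c' sqrt v\<close>. Conversely, such a unit comes from a
  unimodular map taking \<open>x\<close> to \<open>y\<close> precisely when \<open>r (n - m) \<equiv> c' m n\<close> modulo \<open>q\<close>, that is,
  \<open>1/m - 1/n \<equiv> c'/r\<close> (\<open>unimodular_imp_pell\<close>, \<open>pell_imp_unimodular\<close>). Multiplication of units adds the
  quotients \<open>c'/r\<close> modulo \<open>q\<close>, so they form a subgroup of the integers modulo \<open>q\<close>; such a subgroup
  consists of the multiples of a divisor of \<open>q\<close>, and this divisor is \<open>q\<^sub>0\<close>, the value of
  \<^const>\<open>least_divisor\<close> (\<open>pell_ratio_iff_least_divisor_dvd\<close>). Hence \<open>x\<close> and \<open>y\<close> are equivalent if and
  only if \<open>m \<equiv> n\<close> modulo \<open>q\<^sub>0\<close> (\<open>cf_equiv_shifted_root_iff\<close>).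

  The classes therefore correspond to the fibres of the reduction of units modulo \<open>q\<close> to units
  modulo \<open>q\<^sub>0\<close>. This reduction is surjective with fibres of equal size
  (\<open>mod_image_unit_residues\<close>, \<open>card_residue_fibre\<close>), which gives both counts.

  Both classical theorems are proved without convergents. Serret's theorem follows from the Euclidean
  algorithm on the matrix. Both it and Lagrange's theorem work with the complete quotients, and
  periods are tied to them by the fact that an expansion determines its number
  (\<open>expansion_determines_irrational\<close>).
\<close>

section \<open>Continued fractions determine irrational numbers\<close>

text \<open>The iterates of this map at \<open>x\<close> are the complete quotients of \<open>x\<close>; their floors are the
  entries of \<^const>\<open>cf_expansion\<close>.\<close>

definition gauss_step :: "real \<Rightarrow> real" where
  "gauss_step t = 1 / frac t"

lemma frac_irrational:
  assumes "t \<notin> \<rat>"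
  shows "frac t \<notin> \<rat>" "0 < frac t" "frac t < 1"
proof -
  have "t = of_int \<lfloor>t\<rfloor> + frac t" by (simp add: frac_def)
  then show "frac t \<notin> \<rat>" using assms by (metis Rats_add Rats_of_int)
  then show "0 < frac t" using frac_ge_0[of t] by (cases "frac t = 0") auto
  show "frac t < 1" by (rule frac_lt_1)
qed

lemma gauss_step_irrational:
  assumes "t \<notin> \<rat>"
  shows "gauss_step t \<notin> \<rat>" "1 < gauss_step t" "t = of_int \<lfloor>t\<rfloor> + 1 / gauss_step t"
proof -
  have "frac t = 1 / gauss_step t" by (simp add: gauss_step_def)
  then show "gauss_step t \<notin> \<rat>" using frac_irrational(1)[OF assms] by (metis Rats_1 Rats_divide)
  show "1 < gauss_step t" using frac_irrational[OF assms] by (simp add: gauss_step_def)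
  show "t = of_int \<lfloor>t\<rfloor> + 1 / gauss_step t" by (simp add: gauss_step_def frac_def)
qed

lemma iterate_irrational: "x \<notin> \<rat> \<Longrightarrow> (gauss_step ^^ n) x \<notin> \<rat>"
  by (induction n) (simp_all add: gauss_step_irrational)

lemma iterate_gt_1:
  assumes "x \<notin> \<rat>" "0 < n"
  shows "1 < (gauss_step ^^ n) x"
  using assms gauss_step_irrational(2) iterate_irrational by (cases n) auto

lemma cf_expansion_snth: "cf_expansion x !! n = \<lfloor>(gauss_step ^^ n) x\<rfloor>"
  by (simp add: cf_expansion_def gauss_step_def[abs_def])

lemma sdrop_cf_expansion: "sdrop n (cf_expansion x) = cf_expansion ((gauss_step ^^ n) x)"
  by (simp add: cf_expansion_def gauss_step_def[abs_def])

text \<open>With equal floors only the fractional parts \<open>1 / gauss_step x\<close> and \<open>1 / gauss_step y\<close> differ, so one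
  step of the expansion stretches the distance by the product of the two new complete quotients.\<close>

lemma gauss_step_distance:
  assumes "x \<notin> \<rat>" "y \<notin> \<rat>" "\<lfloor>x\<rfloor> = \<lfloor>y\<rfloor>"
  shows "\<bar>x - y\<bar> * (gauss_step x * gauss_step y) = \<bar>gauss_step x - gauss_step y\<bar>"
proof -
  define X Y where "X = gauss_step x" and "Y = gauss_step y"
  have pos: "X > 1" "Y > 1" using gauss_step_irrational assms by (auto simp: X_def Y_def)
  have "x - y = 1 / X - 1 / Y"
    using gauss_step_irrational(3)[OF assms(1)] gauss_step_irrational(3)[OF assms(2)] assms(3)
    unfolding X_def Y_def by linarith
  then have "(x - y) * (X * Y) = Y - X"
    using pos by (simp add: field_simps)
  then have "\<bar>x - y\<bar> * \<bar>X * Y\<bar> = \<bar>Y - X\<bar>" by (metis abs_mult)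
  then show ?thesis using pos unfolding X_def[symmetric] Y_def[symmetric]
    by (simp add: abs_mult abs_minus_commute)
qed

text \<open>One complete quotient may be arbitrarily close to 1, so a single step need not stretch distances
  by a definite factor. Two consecutive steps do: \<open>t * gauss_step t = \<lfloor>t\<rfloor> * gauss_step t + 1\<close>.\<close>

lemma consecutive_quotients_product:
  assumes "t \<notin> \<rat>" "1 < t"
  shows "2 < t * gauss_step t"
proof -
  have T: "1 < gauss_step t" and t: "t = of_int \<lfloor>t\<rfloor> + 1 / gauss_step t"
    using gauss_step_irrational[OF assms(1)] by auto
  have "t * gauss_step t = of_int \<lfloor>t\<rfloor> * gauss_step t + 1"
    using T by (subst t) (simp add: field_simps)
  moreover have "1 * gauss_step t \<le> of_int \<lfloor>t\<rfloor> * gauss_step t"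
    using T assms(2) by (intro mult_right_mono) auto
  ultimately show ?thesis using T by linarith
qed

text \<open>Two steps of a common expansion stretch the distance at least fourfold, while numbers with equal
  floors differ by less than 1; run backwards, this bounds the distance of the starting points.\<close>

lemma same_expansion_distance:
  assumes "x \<notin> \<rat>" "y \<notin> \<rat>" "\<And>n. \<lfloor>(gauss_step ^^ n) x\<rfloor> = \<lfloor>(gauss_step ^^ n) y\<rfloor>"
  shows "\<bar>x - y\<bar> < (1 / 4) ^ k"
  using assms
proof (induction k arbitrary: x y)
  case 0
  from "0.prems"(3)[of 0] show ?case by simp linarith
next
  case (Suc k)
  define x1 y1 where "x1 = gauss_step x" and "y1 = gauss_step y"
  define x2 y2 where "x2 = gauss_step x1" and "y2 = gauss_step y1"
  have irr: "x1 \<notin> \<rat>" "y1 \<notin> \<rat>" "x2 \<notin> \<rat>" "y2 \<notin> \<rat>" and gt: "x1 > 1" "y1 > 1"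
    using Suc.prems(1,2) gauss_step_irrational by (auto simp: x1_def y1_def x2_def y2_def)
  have fl: "\<lfloor>x\<rfloor> = \<lfloor>y\<rfloor>" "\<lfloor>x1\<rfloor> = \<lfloor>y1\<rfloor>"
    using Suc.prems(3)[of 0] Suc.prems(3)[of 1] by (simp_all add: x1_def y1_def)
  have "\<lfloor>(gauss_step ^^ n) x2\<rfloor> = \<lfloor>(gauss_step ^^ n) y2\<rfloor>" for n
    using Suc.prems(3)[of "n + 2"] by (simp add: x1_def y1_def x2_def y2_def funpow_swap1)
  then have IH: "\<bar>x2 - y2\<bar> < (1 / 4) ^ k" using Suc.IH irr by blast
  have big: "2 < x1 * x2" "2 < y1 * y2"
    using consecutive_quotients_product irr gt by (auto simp: x2_def y2_def)
  have "4 \<le> (x1 * x2) * (y1 * y2)"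
    using mult_mono[of 2 "x1 * x2" 2 "y1 * y2"] big by simp
  then have "\<bar>x - y\<bar> * 4 \<le> \<bar>x - y\<bar> * ((x1 * x2) * (y1 * y2))"
    by (intro mult_left_mono) auto
  also have "\<dots> = (\<bar>x - y\<bar> * (x1 * y1)) * (x2 * y2)" by (simp add: ac_simps)
  also have "\<dots> = \<bar>x2 - y2\<bar>"
    using gauss_step_distance[OF Suc.prems(1,2) fl(1)] gauss_step_distance[OF irr(1,2) fl(2)]
    by (simp add: x1_def y1_def x2_def y2_def)
  finally show ?case using IH by simp
qed

text \<open>This replaces the convergence of continued fractions: equality of streams of partial quotients
  turns into equality of numbers, both for tails and, in Lagrange's theorem, for a surd and its
  conjugate.\<close>

lemma expansion_determines_irrational:
  assumes "x \<notin> \<rat>" "y \<notin> \<rat>" "\<And>n. \<lfloor>(gauss_step ^^ n) x\<rfloor> = \<lfloor>(gauss_step ^^ n) y\<rfloor>"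
  shows "x = y"
proof (rule ccontr)
  assume "x \<noteq> y"
  then obtain k where "(1 / 4 :: real) ^ k < \<bar>x - y\<bar>"
    using real_arch_pow_inv[of "\<bar>x - y\<bar>" "1 / 4"] by auto
  with same_expansion_distance[OF assms, of k] show False by simp
qed

section \<open>Serret's theorem: tails and unimodular maps\<close>

definition same_tail :: "real \<Rightarrow> real \<Rightarrow> bool" where
  "same_tail x y \<longleftrightarrow> (\<exists>i j. (gauss_step ^^ i) x = (gauss_step ^^ j) y)"

lemma same_tail_sym: "same_tail x y \<Longrightarrow> same_tail y x"
  unfolding same_tail_def by metis

lemma same_tail_trans:
  assumes "same_tail x y" "same_tail y z"
  shows "same_tail x z"
proof -
  obtain i j k l where ij: "(gauss_step ^^ i) x = (gauss_step ^^ j) y"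
    and kl: "(gauss_step ^^ k) y = (gauss_step ^^ l) z"
    using assms unfolding same_tail_def by auto
  have "(gauss_step ^^ (k + i)) x = (gauss_step ^^ (k + j)) y" by (simp add: funpow_add ij)
  also have "\<dots> = (gauss_step ^^ (j + l)) z"
    by (subst add.commute) (simp add: funpow_add kl)
  finally show ?thesis unfolding same_tail_def by blast
qed

lemma same_tail_gauss_step: "same_tail x (gauss_step x)"
  unfolding same_tail_def by (intro exI[of _ 1] exI[of _ 0]) simp

lemma same_tail_of_step: "gauss_step x = gauss_step y \<Longrightarrow> same_tail x y"
  using same_tail_trans[OF same_tail_gauss_step same_tail_sym] same_tail_gauss_step by metis

lemma same_tail_add_int: "same_tail x (x + of_int n)"
  by (rule same_tail_of_step) (simp add: gauss_step_def frac_def)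

lemma gauss_step_inverse_gt_1: "1 < x \<Longrightarrow> gauss_step (1 / x) = x"
  by (simp add: gauss_step_def frac_eq[THEN iffD2])

text \<open>If the fractional part of \<open>y\<close> is below one half and \<open>t = gauss_step y\<close>, then \<open>t > 2\<close> and
  \<open>gauss_step (- y) = t / (t - 1) = 1 + 1 / (t - 1)\<close>, so the next complete quotient of \<open>- y\<close> is
  \<open>t - 1\<close>, a translate of \<open>t\<close>. One of \<open>x\<close> and \<open>- x\<close> has such a fractional part.\<close>

lemma same_tail_uminus:
  assumes "x \<notin> \<rat>"
  shows "same_tail x (- x)"
proof -
  have small: "same_tail y (- y)" if y: "y \<notin> \<rat>" "frac y < 1 / 2" for y
  proof -
    define f t where "f = frac y" and "t = 1 / f"
    have f: "0 < f" "f < 1 / 2" using frac_irrational(2)[OF y(1)] y(2) by (auto simp: f_def)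
    have t: "2 < t" using f by (simp add: t_def field_simps)
    have "frac (- y) = 1 - f"
      using y(1) Ints_subset_Rats by (auto simp: frac_neg f_def)
    then have "gauss_step (- y) = 1 / (t - 1) + of_int 1"
      using f by (simp add: gauss_step_def t_def field_simps)
    moreover have "gauss_step (1 / (t - 1)) = t + of_int (- 1)"
      using gauss_step_inverse_gt_1[of "t - 1"] t by simp
    moreover have "gauss_step y = t" by (simp add: gauss_step_def t_def f_def)
    ultimately show ?thesis
      using same_tail_gauss_step same_tail_add_int same_tail_sym same_tail_trans by metis
  qed
  consider "frac x < 1 / 2" | "frac x > 1 / 2"
    using frac_irrational(1)[OF assms] by (cases "frac x = 1 / 2") force+
  then show ?thesis
  proof cases
    case 1
    then show ?thesis using small assms by blast
  next
    case 2
    have "frac (- x) = 1 - frac x" using assms Ints_subset_Rats by (auto simp: frac_neg)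
    moreover have "- x \<notin> \<rat>" using assms by (metis Rats_minus_iff)
    ultimately show ?thesis using small[of "- x"] 2 same_tail_sym by auto
  qed
qed

lemma same_tail_inverse:
  assumes "x \<notin> \<rat>"
  shows "same_tail x (1 / x)"
proof -
  have positive: "same_tail y (1 / y)" if y: "y \<notin> \<rat>" "0 < y" for y :: real
  proof -
    have "y \<noteq> 1" using y(1) by auto
    then consider "1 < y" | "1 < 1 / y" using y(2) by (cases "1 < y") (auto simp: field_simps)
    then show ?thesis
    proof cases
      case 1
      then show ?thesis using gauss_step_inverse_gt_1 same_tail_gauss_step same_tail_sym by metis
    next
      case 2
      then show ?thesis using gauss_step_inverse_gt_1[of "1 / y"] same_tail_gauss_step[of y] by simp
    qed
  qed
  have irr: "- x \<notin> \<rat>" "1 / x \<notin> \<rat>"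
    using assms by (auto simp: Rats_minus_iff divide_inverse)
  show ?thesis
  proof (cases "0 < x")
    case False
    then have "same_tail (- x) (1 / (- x))" using positive[of "- x"] irr assms by (cases "x = 0") auto
    moreover have "1 / (- x) = - (1 / x)" by simp
    ultimately show ?thesis
      using same_tail_uminus[OF assms] same_tail_uminus[OF irr(2)] same_tail_sym same_tail_trans by metis
  qed (use positive assms in blast)
qed

text \<open>The equation is \<open>y = (a x + b) / (c x + d)\<close> with the denominator cleared; for irrational \<open>x\<close> the
  determinant condition makes the denominator nonzero.\<close>

definition unimodular_related :: "real \<Rightarrow> real \<Rightarrow> bool" where
  "unimodular_related x y \<longleftrightarrow> (\<exists>a b c d :: int. a * d - b * c \<in> {1, -1} \<and>
     y * (of_int c * x + of_int d) = of_int a * x + of_int b)"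

text \<open>Translations, negation and inversion preserve tails and generate all unimodular maps. The Euclidean
  algorithm on the first column \<open>(a, c)\<close> finds the generators: subtracting \<open>a div c\<close> from \<open>y\<close> and
  inverting replaces \<open>c\<close> by \<open>a mod c\<close>.\<close>

lemma unimodular_imp_same_tail:
  assumes "x \<notin> \<rat>" "y \<notin> \<rat>" "unimodular_related x y"
  shows "same_tail x y"
proof -
  have "same_tail x y" if "y \<notin> \<rat>" "a * d - b * c \<in> {1, -1}"
      "y * (of_int c * x + of_int d) = of_int a * x + of_int b" for a b c d :: int and y
    using that
  proof (induction "nat \<bar>c\<bar>" arbitrary: a b c d y rule: less_induct)
    case less
    show ?case
    \<comment> \<open>For \<open>c = 0\<close> the diagonal entries are units, and the map is \<open>x \<mapsto> \<plusminus>x + n\<close>.\<close>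
    proof (cases "c = 0")
      case True
      then have "\<bar>a * d\<bar> = 1" "\<bar>d * a\<bar> = 1" using less.prems(2) by (auto simp: mult.commute)
      then have "\<bar>a\<bar> = 1" "\<bar>d\<bar> = 1" by (blast dest: abs_zmult_eq_1)+
      then have "(a = 1 \<or> a = -1) \<and> (d = 1 \<or> d = -1)" by linarith
      then have "y = x + of_int b \<or> y = x + of_int (- b) \<or>
          y = - x + of_int b \<or> y = - x + of_int (- b)"
        using less.prems(3) True by auto
      moreover have "same_tail x (- x + of_int n)" for n
        by (rule same_tail_trans[OF same_tail_uminus[OF assms(1)] same_tail_add_int])
      ultimately show ?thesis using same_tail_add_int[of x] by (elim disjE) (simp_all only:)
    next
      case False
      define k where "k = a div c"
      define y' where "y' = 1 / (y - of_int k)"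
      have irr: "y - of_int k \<notin> \<rat>" using less.prems(1) by (metis Rats_add Rats_of_int diff_add_cancel)
      then have y': "y' \<notin> \<rat>" by (auto simp: y'_def divide_inverse)
      have "y - of_int k \<noteq> 0" using irr by auto
      moreover have "(y - of_int k) * (of_int c * x + of_int d)
          = of_int (a - k * c) * x + of_int (b - k * d)"
        using less.prems(3) by (simp add: algebra_simps)
      ultimately have eq: "y' * (of_int (a - k * c) * x + of_int (b - k * d))
          = of_int c * x + of_int d"
        unfolding y'_def by (simp add: field_simps)
      have "a - k * c = a mod c" by (simp add: k_def minus_div_mult_eq_mod)
      then have "nat \<bar>a - k * c\<bar> < nat \<bar>c\<bar>" using False abs_mod_less[of c a] by simp
      moreover have "c * (b - k * d) - d * (a - k * c) \<in> {1, -1}"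
        using less.prems(2) by (auto simp: algebra_simps)
      ultimately have "same_tail x y'" using less.hyps y' eq by blast
      moreover have "same_tail (y - of_int k) y'"
        unfolding y'_def by (rule same_tail_inverse[OF irr])
      moreover have "same_tail (y - of_int k) y"
        using same_tail_add_int[of "y - of_int k" k] by simp
      ultimately show ?thesis using same_tail_sym same_tail_trans by metis
    qed
  qed
  then show ?thesis using assms unfolding unimodular_related_def by blast
qed

lemma unimodular_related_refl: "unimodular_related x x"
  unfolding unimodular_related_def
  by (rule exI[of _ 1], rule exI[of _ 0], rule exI[of _ 0], rule exI[of _ 1]) simp

lemma unimodular_related_sym:
  assumes "unimodular_related x y"
  shows "unimodular_related y x"
proof -
  obtain a b c d :: int where det: "a * d - b * c \<in> {1, -1}"
    and eq: "y * (of_int c * x + of_int d) = of_int a * x + of_int b"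
    using assms unfolding unimodular_related_def by blast
  have "d * a - (- b) * (- c) \<in> {1, -1}" using det by (simp add: algebra_simps)
  moreover have "x * (of_int (- c) * y + of_int a) = of_int d * y + of_int (- b)"
    using eq by (simp add: algebra_simps)
  ultimately show ?thesis unfolding unimodular_related_def by blast
qed

lemma unimodular_related_trans:
  assumes "unimodular_related x y" "unimodular_related y z" "x \<notin> \<rat>"
  shows "unimodular_related x z"
proof -
  obtain a b c d :: int where det: "a * d - b * c \<in> {1, -1}"
    and eq: "y * (of_int c * x + of_int d) = of_int a * x + of_int b"
    using assms unfolding unimodular_related_def by blast
  obtain a' b' c' d' :: int where det': "a' * d' - b' * c' \<in> {1, -1}"
    and eq': "z * (of_int c' * y + of_int d') = of_int a' * y + of_int b'"
    using assms unfolding unimodular_related_def by blast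
  define w where "w = of_int c * x + of_int d"
  have w: "w * y = of_int a * x + of_int b" using eq by (simp add: w_def algebra_simps)
  have "(a' * a + b' * c) * (c' * b + d' * d) - (a' * b + b' * d) * (c' * a + d' * c)
      = (a * d - b * c) * (a' * d' - b' * c')"
    by (simp add: algebra_simps)
  then have "(a' * a + b' * c) * (c' * b + d' * d) - (a' * b + b' * d) * (c' * a + d' * c) \<in> {1, -1}"
    using det det' by auto
  moreover have "z * (of_int (c' * a + d' * c) * x + of_int (c' * b + d' * d))
      = of_int (a' * a + b' * c) * x + of_int (a' * b + b' * d)"
  proof -
    have "z * (of_int (c' * a + d' * c) * x + of_int (c' * b + d' * d))
        = z * (of_int c' * (w * y) + of_int d' * w)"
      unfolding w by (simp add: w_def algebra_simps)
    also have "\<dots> = w * (z * (of_int c' * y + of_int d'))" by (simp add: algebra_simps)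
    also have "\<dots> = of_int a' * (w * y) + of_int b' * w" unfolding eq' by (simp add: algebra_simps)
    also have "\<dots> = of_int (a' * a + b' * c) * x + of_int (a' * b + b' * d)"
      unfolding w by (simp add: w_def algebra_simps)
    finally show ?thesis .
  qed
  ultimately show ?thesis unfolding unimodular_related_def by blast
qed

lemma unimodular_related_iterate:
  assumes "x \<notin> \<rat>"
  shows "unimodular_related x ((gauss_step ^^ n) x)"
proof (induction n)
  case 0
  show ?case using unimodular_related_refl by simp
next
  case (Suc n)
  define y where "y = (gauss_step ^^ n) x"
  have y: "y \<notin> \<rat>" unfolding y_def by (rule iterate_irrational[OF assms])
  have "gauss_step y * (of_int 1 * y + of_int (- \<lfloor>y\<rfloor>)) = of_int 0 * y + of_int 1"
    using frac_irrational(2)[OF y] by (simp add: gauss_step_def frac_def)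
  then have "unimodular_related y (gauss_step y)"
    unfolding unimodular_related_def
    by (intro exI[of _ 0] exI[of _ 1] exI[of _ "- \<lfloor>y\<rfloor>"] exI[of _ "1::int"] conjI) auto
  then show ?case using unimodular_related_trans[OF Suc.IH _ assms] by (simp add: y_def)
qed

theorem same_tail_iff_unimodular_related:
  assumes "x \<notin> \<rat>" "y \<notin> \<rat>"
  shows "same_tail x y \<longleftrightarrow> unimodular_related x y"
proof
  assume "same_tail x y"
  then obtain i j where "(gauss_step ^^ i) x = (gauss_step ^^ j) y" unfolding same_tail_def by blast
  then show "unimodular_related x y"
    using unimodular_related_iterate[OF assms(1), of i] unimodular_related_iterate[OF assms(2), of j]
      unimodular_related_sym unimodular_related_trans assms(1) by metis
qed (rule unimodular_imp_same_tail[OF assms])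

section \<open>Lagrange's theorem\<close>

text \<open>The divisibility condition keeps the numerators and denominators integral along the continued
  fraction algorithm: the next denominator is \<open>(D - P'\<^sup>2) / Q\<close>.\<close>

definition conjugate_surds :: "int \<Rightarrow> real \<Rightarrow> real \<Rightarrow> bool" where
  "conjugate_surds D x z \<longleftrightarrow> 0 \<le> D \<and> (\<exists>P Q :: int. Q \<noteq> 0 \<and> Q dvd D - P\<^sup>2 \<and>
     x = (of_int P + sqrt (of_int D)) / of_int Q \<and>
     z = (of_int P - sqrt (of_int D)) / of_int Q)"

lemma quadratic_irrational_conjugate_surds:
  assumes "quadratic_irrational x"
  obtains D z where "sqrt (of_int D) \<notin> \<rat>" "conjugate_surds D x z"
proof -
  obtain a b c :: int where x: "x \<notin> \<rat>" and a: "a \<noteq> 0"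
    and root: "of_int a * x\<^sup>2 + of_int b * x + of_int c = 0"
    using assms unfolding quadratic_irrational_def by blast
  define D where "D = b\<^sup>2 - 4 * a * c"
  define s where "s = 2 * of_int a * x + of_int b"
  have "s\<^sup>2 = 4 * of_int a * (of_int a * x\<^sup>2 + of_int b * x + of_int c) + of_int D"
    by (simp add: s_def D_def power2_eq_square algebra_simps)
  then have s2: "s\<^sup>2 = of_int D" using root by simp
  have x_eq: "x = (s - of_int b) / (2 * of_int a)" using a by (simp add: s_def)
  have s_irr: "s \<notin> \<rat>"
  proof
    assume "s \<in> \<rat>"
    then have "(s - of_int b) / (2 * of_int a) \<in> \<rat>" by auto
    then show False using x x_eq by simp
  qed
  have sqrt_D: "sqrt (of_int D) = \<bar>s\<bar>" using s2 by (metis real_sqrt_abs)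
  have "0 < s\<^sup>2" using s_irr by auto
  then have D_pos: "0 < D" using s2 by simp
  have "sqrt (of_int D) \<notin> \<rat>" using s_irr sqrt_D by (auto simp: abs_if)
  moreover have "\<exists>z. conjugate_surds D x z"
  proof (cases "0 \<le> s")
    case True
    have "0 \<le> D" "2 * a dvd D - (- b)\<^sup>2" using D_pos by (simp_all add: D_def)
    moreover have "x = (of_int (- b) + sqrt (of_int D)) / of_int (2 * a)"
      using True x_eq sqrt_D by simp
    ultimately show ?thesis using a unfolding conjugate_surds_def
      by (metis mult_eq_0_iff zero_neq_numeral)
  next
    case False
    have "0 \<le> D" "- (2 * a) dvd D - b\<^sup>2" using D_pos by (simp_all add: D_def)
    moreover have "x = (of_int b + sqrt (of_int D)) / of_int (- (2 * a))"
      using False x_eq sqrt_D a by (simp add: field_simps)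
    ultimately show ?thesis using a unfolding conjugate_surds_def
      by (metis mult_eq_0_iff neg_equal_0_iff_equal zero_neq_numeral)
  qed
  ultimately show ?thesis using that by blast
qed

lemma conjugate_surds_irrational:
  assumes "conjugate_surds D x z" "sqrt (of_int D) \<notin> \<rat>"
  shows "z \<notin> \<rat>" "x \<noteq> z"
proof -
  obtain P Q :: int where Q: "Q \<noteq> 0"
    and x: "x = (of_int P + sqrt (of_int D)) / of_int Q"
    and z: "z = (of_int P - sqrt (of_int D)) / of_int Q"
    using assms(1) unfolding conjugate_surds_def by blast
  have sqrt_eq: "sqrt (of_int D) = of_int P - of_int Q * z" using Q z by simp
  show "z \<notin> \<rat>"
  proof
    assume "z \<in> \<rat>"
    then have "of_int P - of_int Q * z \<in> \<rat>" by auto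
    then show False using assms(2) sqrt_eq by simp
  qed
  show "x \<noteq> z" using assms(2) Q by (auto simp: x z)
qed

text \<open>With \<open>P' = a Q - P\<close> and \<open>Q Q' = D - P'\<^sup>2\<close>, rationalising the denominator of \<open>1 / (x - a)\<close> gives
  \<open>(P' + sqrt D) / Q'\<close>. The discriminant stays the same, which confines the complete quotients
  to one family of surds.\<close>

lemma conjugate_surds_step:
  assumes "conjugate_surds D x z" "sqrt (of_int D) \<notin> \<rat>"
  shows "conjugate_surds D (1 / (x - of_int a)) (1 / (z - of_int a))"
proof -
  obtain P Q :: int where Q: "Q \<noteq> 0" "Q dvd D - P\<^sup>2"
    and x: "x = (of_int P + sqrt (of_int D)) / of_int Q"
    and z: "z = (of_int P - sqrt (of_int D)) / of_int Q"
    using assms(1) unfolding conjugate_surds_def by blast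
  define w where "w = sqrt (of_int D)"
  define P' where "P' = a * Q - P"
  have "D - P'\<^sup>2 = (D - P\<^sup>2) + Q * (a * (2 * P - a * Q))"
    by (simp add: P'_def power2_eq_square algebra_simps)
  then have "Q dvd D - P'\<^sup>2" using Q(2) by (metis dvd_add dvd_triv_left)
  then obtain Q' where Q': "D - P'\<^sup>2 = Q * Q'" by blast
  have plus: "w + of_int P' \<noteq> 0" and minus: "w - of_int P' \<noteq> 0"
    using assms(2) by (auto simp: w_def[symmetric] eq_neg_iff_add_eq_0[symmetric])
  have D_nonneg: "0 \<le> D" using assms(1) by (simp add: conjugate_surds_def)
  have "w\<^sup>2 = of_int D" using D_nonneg by (simp add: w_def)
  then have prod: "(w + of_int P') * (w - of_int P') = of_int Q * of_int Q'"
    using arg_cong[OF Q', of real_of_int] by (simp add: power2_eq_square algebra_simps)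
  then have Q'0: "Q' \<noteq> 0" using plus minus by auto
  have "x - of_int a = (w - of_int P') / of_int Q"
    using Q(1) by (simp add: x w_def P'_def field_simps)
  then have "1 / (x - of_int a) = of_int Q / (w - of_int P')" by simp
  also have "\<dots> = (of_int P' + w) / of_int Q'"
    using Q'0 minus prod by (simp add: frac_eq_eq add.commute)
  finally have x_step: "1 / (x - of_int a) = (of_int P' + w) / of_int Q'" .
  have "z - of_int a = (- (w + of_int P')) / of_int Q"
    using Q(1) by (simp add: z w_def P'_def field_simps)
  then have "1 / (z - of_int a) = of_int Q / (- (w + of_int P'))" by simp
  also have "\<dots> = (of_int P' - w) / of_int Q'"
  proof (subst frac_eq_eq)
    show "of_int Q * of_int Q' = (of_int P' - w) * - (w + of_int P')"
      using prod by (simp add: algebra_simps)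
  qed (use Q'0 plus in auto)
  finally have z_step: "1 / (z - of_int a) = (of_int P' - w) / of_int Q'" .
  have "Q' dvd D - P'\<^sup>2" using Q' by simp
  then show ?thesis using x_step z_step Q'0 D_nonneg unfolding conjugate_surds_def w_def by blast
qed

text \<open>The conjugates of the complete quotients of \<open>x\<close>: the algorithm is run on \<open>z\<close> with the floors of the
  complete quotients of \<open>x\<close> instead of its own.\<close>

primrec conjugate_quotient :: "real \<Rightarrow> real \<Rightarrow> nat \<Rightarrow> real" where
  "conjugate_quotient x z 0 = z"
| "conjugate_quotient x z (Suc n) =
     1 / (conjugate_quotient x z n - of_int \<lfloor>(gauss_step ^^ n) x\<rfloor>)"

lemma conjugate_surds_iterate:
  assumes "conjugate_surds D x z" "sqrt (of_int D) \<notin> \<rat>"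
  shows "conjugate_surds D ((gauss_step ^^ n) x) (conjugate_quotient x z n)"
proof (induction n)
  case (Suc n)
  show ?case using conjugate_surds_step[OF Suc.IH assms(2), of "\<lfloor>(gauss_step ^^ n) x\<rfloor>"]
    by (simp add: gauss_step_def[of "(gauss_step ^^ n) x"] frac_def)
qed (simp add: assms)

text \<open>If no conjugate quotient with positive index is negative, then every conjugate quotient exceeds the
  floor that the next step subtracts from it, and by less than 1 because its successor exceeds 1.
  The floors subtracted from \<open>z\<close> are then its own, so \<open>x\<close> and \<open>z\<close> have the same expansion and
  coincide.\<close>

lemma conjugate_eventually_negative:
  assumes x: "x \<notin> \<rat>" and "x \<noteq> z" and z: "\<And>n. conjugate_quotient x z n \<notin> \<rat>"
  shows "\<exists>n>0. conjugate_quotient x z n < 0"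
proof (rule ccontr)
  assume "\<not> ?thesis"
  moreover have "conjugate_quotient x z n \<noteq> 0" for n using z[of n] by auto
  ultimately have pos: "0 < conjugate_quotient x z (Suc n)" for n
    by (metis linorder_neqE_linordered_idom zero_less_Suc)
  have above: "of_int \<lfloor>(gauss_step ^^ n) x\<rfloor> < conjugate_quotient x z n" for n
    using pos[of n] by (simp add: zero_less_divide_iff)
  have floor_eq: "\<lfloor>conjugate_quotient x z n\<rfloor> = \<lfloor>(gauss_step ^^ n) x\<rfloor>" for n
  proof -
    have "1 \<le> \<lfloor>(gauss_step ^^ Suc n) x\<rfloor>" using iterate_gt_1[OF x, of "Suc n"] by simp
    then have "1 < conjugate_quotient x z (Suc n)" using above[of "Suc n"] by linarith
    then have "conjugate_quotient x z n - of_int \<lfloor>(gauss_step ^^ n) x\<rfloor> < 1"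
      using above[of n] by (simp add: field_simps)
    then show ?thesis using above[of n] by (intro floor_unique) linarith+
  qed
  have iterate: "conjugate_quotient x z n = (gauss_step ^^ n) z" for n
  proof (induction n)
    case (Suc n)
    then show ?case by (simp add: gauss_step_def frac_def floor_eq[symmetric])
  qed simp
  have "x = z"
  proof (rule expansion_determines_irrational)
    show "z \<notin> \<rat>" using z[of 0] by simp
    show "\<lfloor>(gauss_step ^^ n) x\<rfloor> = \<lfloor>(gauss_step ^^ n) z\<rfloor>" for n
      using floor_eq[of n] by (simp add: iterate)
  qed (fact x)
  with \<open>x \<noteq> z\<close> show False by contradiction
qed

lemma conjugate_stays_negative:
  assumes x: "x \<notin> \<rat>" and "0 < n" "conjugate_quotient x z n < 0" "n \<le> m"
  shows "conjugate_quotient x z m < 0"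
  using \<open>n \<le> m\<close>
proof (induction m rule: dec_induct)
  case (step m)
  have "1 \<le> \<lfloor>(gauss_step ^^ m) x\<rfloor>"
    using iterate_gt_1[OF x, of m] \<open>0 < n\<close> step.hyps by simp
  then have "conjugate_quotient x z m - of_int \<lfloor>(gauss_step ^^ m) x\<rfloor> < 0"
    using step.IH by linarith
  then show ?case by simp
qed (fact assms(3))

text \<open>Opposite signs mean \<open>P\<^sup>2 - D < 0\<close>, which bounds \<open>P\<close>; as \<open>Q\<close> divides the positive number
  \<open>D - P\<^sup>2\<close>, it bounds \<open>Q\<close> as well.\<close>

lemma finite_surds_opposite_signs:
  "finite {x. \<exists>z. conjugate_surds D x z \<and> z < 0 \<and> 0 < x}"
proof (rule finite_surj)
  show "finite ({- D..D} \<times> {- D..D})" by simp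
  show "{x. \<exists>z. conjugate_surds D x z \<and> z < 0 \<and> 0 < x}
    \<subseteq> (\<lambda>(P, Q). (of_int P + sqrt (of_int D)) / of_int Q) ` ({- D..D} \<times> {- D..D})"
  proof
    fix x assume "x \<in> {x. \<exists>z. conjugate_surds D x z \<and> z < 0 \<and> 0 < x}"
    then obtain z P Q where D: "0 \<le> D" and Q: "Q \<noteq> 0" "Q dvd D - P\<^sup>2"
      and x: "x = (of_int P + sqrt (of_int D)) / of_int Q" "0 < x"
      and z: "z = (of_int P - sqrt (of_int D)) / of_int Q" "z < 0"
      unfolding conjugate_surds_def by blast
    have "x * z < 0" using x(2) z(2) by (rule mult_pos_neg)
    have "(of_int P + sqrt (of_int D)) * (of_int P - sqrt (of_int D))
        = of_int Q * of_int Q * (x * z)"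
      using Q(1) by (simp add: x(1) z(1))
    also have "\<dots> < 0" using Q(1) by (intro mult_pos_neg[OF _ \<open>x * z < 0\<close>]) (auto simp: zero_less_mult_iff)
    finally have neg: "(of_int P)\<^sup>2 - (sqrt (of_int D))\<^sup>2 < 0"
      by (simp add: power2_eq_square algebra_simps)
    have "(of_int P)\<^sup>2 < real_of_int D" using neg D by simp
    then have P: "P\<^sup>2 < D" by (metis of_int_less_iff of_int_power)
    then have "\<bar>Q\<bar> \<le> D - P\<^sup>2" using Q(2) by (auto intro!: zdvd_imp_le)
    moreover have "0 \<le> P\<^sup>2" by simp
    ultimately have "\<bar>Q\<bar> \<le> D" by linarith
    moreover have "\<bar>P\<bar> \<le> P\<^sup>2"
      by (cases "P = 0") (auto simp: power2_eq_square abs_mult_self_eq[of P, symmetric] simp del: abs_mult_self_eq)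
    then have "\<bar>P\<bar> \<le> D" using P by linarith
    ultimately show "x \<in> (\<lambda>(P, Q). (of_int P + sqrt (of_int D)) / of_int Q) ` ({- D..D} \<times> {- D..D})"
      using x(1) by force
  qed
qed

text \<open>Lagrange's theorem. From some index on, the complete quotients are positive with negative
  conjugates, hence lie in a finite set, and one of them recurs.\<close>

theorem quadratic_irrational_periodic:
  assumes "quadratic_irrational x"
  obtains n p where "0 < p" "(gauss_step ^^ (n + p)) x = (gauss_step ^^ n) x"
proof -
  have x: "x \<notin> \<rat>" using assms by (simp add: quadratic_irrational_def)
  obtain D z where D: "sqrt (of_int D) \<notin> \<rat>" "conjugate_surds D x z"
    using quadratic_irrational_conjugate_surds[OF assms] .
  note surds = conjugate_surds_iterate[OF D(2,1)]
  obtain N where N: "0 < N" "conjugate_quotient x z N < 0"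
    using conjugate_eventually_negative[OF x] conjugate_surds_irrational[OF _ D(1)] surds D(2)
    by metis
  have "(gauss_step ^^ n) x \<in> {y. \<exists>z. conjugate_surds D y z \<and> z < 0 \<and> 0 < y}" if "N \<le> n" for n
    using surds[of n] conjugate_stays_negative[OF x N that] iterate_gt_1[OF x, of n] N(1) that
    by fastforce
  then have "finite ((\<lambda>n. (gauss_step ^^ n) x) ` {N..})"
    by (intro finite_subset[OF _ finite_surds_opposite_signs[of D]]) auto
  then have "\<not> inj_on (\<lambda>n. (gauss_step ^^ n) x) {N..}"
    using finite_imageD infinite_Ici by blast
  then obtain i j where ij: "i < j" "(gauss_step ^^ i) x = (gauss_step ^^ j) x"
    unfolding inj_on_def by (metis linorder_neqE_nat)
  show ?thesis using that[of "j - i" i] ij by simp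
qed

section \<open>Equivalence through periods\<close>

lemma quadratic_irrational_iterate_cycle:
  assumes "quadratic_irrational x"
  obtains n bs where "bs \<noteq> []" "cf_expansion ((gauss_step ^^ n) x) = cycle bs"
proof -
  obtain n p where p: "0 < p" and eq: "(gauss_step ^^ (n + p)) x = (gauss_step ^^ n) x"
    using quadratic_irrational_periodic[OF assms] .
  define s where "s = cf_expansion ((gauss_step ^^ n) x)"
  have "sdrop p s = cf_expansion ((gauss_step ^^ (p + n)) x)"
    by (simp add: s_def sdrop_cf_expansion funpow_add)
  then have "sdrop p s = s" using eq by (simp only: s_def add.commute)
  then have unfold_s: "s = stake p s @- s" using stake_sdrop by metis
  have ne: "stake p s \<noteq> []" using p by (cases p) auto
  define bs where "bs = stake p s"
  \<comment> \<open>A stream that reproduces itself after the prefix \<open>bs\<close> is its cycle; the bisimulation rotates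
    \<open>bs\<close> at each step.\<close>
  have "s = cycle bs" if "s = bs @- s" "bs \<noteq> []" for bs :: "int list"
    using that
  proof (coinduction arbitrary: s bs)
    case Eq_stream
    then obtain b bs' where bs: "bs = b # bs'" by (cases bs) auto
    have "stl s = bs' @- s" "shd s = b" using Eq_stream(1) bs by (metis shift.simps(2) stream.sel)+
    moreover have "s = b ## stl s" using \<open>shd s = b\<close> by (metis stream.collapse)
    ultimately have "stl s = (bs' @ [b]) @- stl s" by (metis shift.simps shift_append)
    moreover have "shd (cycle bs) = b" "stl (cycle bs) = cycle (bs' @ [b])"
      by (simp_all add: bs)
    ultimately show ?case using \<open>shd s = b\<close> by blast
  qed
  then have "s = cycle (stake p s)" using unfold_s ne by blast
  then show ?thesis using that ne unfolding s_def by blast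
qed

text \<open>A common period means that two tails have the same expansion, so the complete quotients that they
  belong to are equal. Conversely, a common complete quotient has a periodic tail by Lagrange's
  theorem, and this tail serves as the period of both numbers.\<close>

theorem cf_equiv_iff_same_tail:
  "(x, y) \<in> cf_equiv \<longleftrightarrow> quadratic_irrational x \<and> quadratic_irrational y \<and> same_tail x y"
proof
  assume "(x, y) \<in> cf_equiv"
  then obtain as bs cs where x: "quadratic_irrational x" and y: "quadratic_irrational y"
    and exp: "cf_expansion x = as @- cycle bs" "cf_expansion y = cs @- cycle bs"
    unfolding cf_equiv_def by auto
  define X Y where "X = (gauss_step ^^ length as) x" and "Y = (gauss_step ^^ length cs) y"
  have "cf_expansion X = cf_expansion Y"
    using exp by (simp add: X_def Y_def sdrop_cf_expansion[symmetric] sdrop_shift)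
  then have "\<lfloor>(gauss_step ^^ n) X\<rfloor> = \<lfloor>(gauss_step ^^ n) Y\<rfloor>" for n
    using cf_expansion_snth by metis
  moreover have "X \<notin> \<rat>" "Y \<notin> \<rat>"
    using x y iterate_irrational by (auto simp: X_def Y_def quadratic_irrational_def)
  ultimately have "X = Y" using expansion_determines_irrational by blast
  then show "quadratic_irrational x \<and> quadratic_irrational y \<and> same_tail x y"
    using x y unfolding X_def Y_def same_tail_def by blast
next
  assume asm: "quadratic_irrational x \<and> quadratic_irrational y \<and> same_tail x y"
  then obtain i j where ij: "(gauss_step ^^ i) x = (gauss_step ^^ j) y"
    unfolding same_tail_def by blast
  obtain n bs where bs: "bs \<noteq> []" "cf_expansion ((gauss_step ^^ n) x) = cycle bs"
    using quadratic_irrational_iterate_cycle[OF conjunct1[OF asm]] .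
  \<comment> \<open>The periodic tail of \<open>x\<close> starts at index \<open>n\<close>; \<open>i\<close> further steps reach an index whose complete
    quotient also occurs in \<open>y\<close>, and rotate the period.\<close>
  define cs where "cs = rotate (i mod length bs) bs"
  have tail: "cf_expansion ((gauss_step ^^ (i + n)) x) = cycle cs"
    using bs sdrop_cycle[of bs i] by (simp add: funpow_add sdrop_cf_expansion[symmetric] cs_def)
  have "(gauss_step ^^ (n + i)) x = (gauss_step ^^ (n + j)) y"
    by (simp add: funpow_add ij)
  then have tail': "cf_expansion ((gauss_step ^^ (n + j)) y) = cycle cs"
    using tail by (simp add: add.commute)
  have "cf_expansion x = stake (i + n) (cf_expansion x) @- cycle cs"
    using tail stake_sdrop[of "i + n" "cf_expansion x"] by (simp add: sdrop_cf_expansion)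
  moreover have "cf_expansion y = stake (n + j) (cf_expansion y) @- cycle cs"
    using tail' stake_sdrop[of "n + j" "cf_expansion y"] by (simp add: sdrop_cf_expansion)
  moreover have "cs \<noteq> []" using bs(1) by (simp add: cs_def)
  ultimately show "(x, y) \<in> cf_equiv" using asm unfolding cf_equiv_def by blast
qed

corollary cf_equiv_iff_unimodular_related:
  assumes "quadratic_irrational x" "quadratic_irrational y"
  shows "(x, y) \<in> cf_equiv \<longleftrightarrow> unimodular_related x y"
  using assms same_tail_iff_unimodular_related
  by (simp add: cf_equiv_iff_same_tail quadratic_irrational_def)

section \<open>Unimodular maps between shifted square roots\<close>

lemma sqrt_nonsquare_irrational:
  fixes v :: nat
  assumes "\<nexists>k. v = k\<^sup>2"
  shows "sqrt (of_nat v) \<notin> \<rat>"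
proof
  assume "sqrt (of_nat v) \<in> \<rat>"
  then obtain a b :: nat where b: "b \<noteq> 0" and ab: "\<bar>sqrt (of_nat v)\<bar> = real a / real b"
    and "coprime a b"
    by (rule Rats_abs_nat_div_natE)
  have "real v = (real a / real b)\<^sup>2" using ab by (metis power2_abs real_sqrt_pow2 of_nat_0_le_iff)
  then have "real (v * b\<^sup>2) = real (a\<^sup>2)" using b by (simp add: field_simps)
  then have eq: "v * b\<^sup>2 = a\<^sup>2" by (simp only: of_nat_eq_iff)
  then have "b\<^sup>2 dvd a\<^sup>2" by (metis dvd_triv_right)
  then have "b dvd a" by simp
  with \<open>coprime a b\<close> have "b = 1" by (metis coprime_absorb_right nat_dvd_1_iff_1)
  with eq have "v = a\<^sup>2" by simp
  with assms show False by blast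
qed

lemma linear_combination_irrational_zero:
  fixes s :: real and a b :: int
  assumes "s \<notin> \<rat>" "of_int a + of_int b * s = 0"
  shows "a = 0" "b = 0"
proof -
  show "b = 0"
  proof (rule ccontr)
    assume "b \<noteq> 0"
    then have "s = - of_int a / of_int b" using assms(2) by (simp add: field_simps)
    then show False using assms(1) by auto
  qed
  then show "a = 0" using assms(2) by simp
qed

definition shifted_root :: "nat \<Rightarrow> nat \<Rightarrow> int \<Rightarrow> real" where
  "shifted_root v q m = of_int m / of_nat q + sqrt (of_nat v)"

lemma quadratic_irrational_shifted_root:
  assumes "0 < q" "\<nexists>k. v = k\<^sup>2"
  shows "quadratic_irrational (shifted_root v q m)"
  unfolding quadratic_irrational_def
proof (intro conjI)
  show "shifted_root v q m \<notin> \<rat>"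
  proof
    assume "shifted_root v q m \<in> \<rat>"
    then have "shifted_root v q m - of_int m / of_nat q \<in> \<rat>" by auto
    then show False using sqrt_nonsquare_irrational[OF assms(2)] by (simp add: shifted_root_def)
  qed
  have "of_int ((int q)\<^sup>2) * (shifted_root v q m)\<^sup>2 + of_int (- 2 * int q * m) * shifted_root v q m
      + of_int (m\<^sup>2 - (int q)\<^sup>2 * int v) = 0"
    using assms(1) by (simp add: shifted_root_def power2_eq_square field_simps)
  then show "\<exists>a b c :: int. a \<noteq> 0 \<and> of_int a * (shifted_root v q m)\<^sup>2
      + of_int b * shifted_root v q m + of_int c = 0"
    using assms(1) by (metis of_nat_eq_0_iff power_eq_0_iff less_numeral_extra(3))
qed

text \<open>Comparing rational parts and coefficients of \<open>sqrt v\<close> in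
  \<open>(n/q + sqrt v) (c x + d) = a x + b\<close> with \<open>x = m/q + sqrt v\<close> determines \<open>a\<close> and \<open>b\<close> from \<open>c\<close>
  and \<open>d\<close>. Then \<open>c x + d = (d + c m/q) + c sqrt v\<close> has the determinant as its norm, so
  \<open>d + c m/q\<close> is an integer, \<open>c\<close> is a multiple of \<open>q\<close>, and the integrality of \<open>b\<close> becomes
  the congruence.\<close>

lemma unimodular_imp_pell:
  fixes m n :: int
  assumes v: "\<nexists>k. v = k\<^sup>2" and q: "0 < q" and m: "coprime m (int q)"
    and rel: "unimodular_related (shifted_root v q m) (shifted_root v q n)"
  obtains r c :: int where "r\<^sup>2 - (int q * c)\<^sup>2 * int v \<in> {1, -1}" "int q dvd r * (n - m) - c * m * n"
proof -
  define s where "s = sqrt (of_nat v)"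
  define p where "p = int q"
  have p: "p \<noteq> 0" using q by (simp add: p_def)
  have s: "s \<notin> \<rat>" unfolding s_def by (rule sqrt_nonsquare_irrational[OF v])
  have s2: "s * s = real v" by (simp add: s_def)
  obtain a b c d :: int where det: "a * d - b * c \<in> {1, -1}"
    and eq: "(of_int n / of_int p + s) * (of_int c * (of_int m / of_int p + s) + of_int d)
      = of_int a * (of_int m / of_int p + s) + of_int b"
    using rel by (auto simp: unimodular_related_def shifted_root_def p_def s_def)
  \<comment> \<open>\<open>A\<close> and \<open>B\<close> are the two coefficients, scaled by \<open>p\<^sup>2\<close> to be integers.\<close>
  define A where "A = n * c * m + n * d * p + p\<^sup>2 * c * int v - p * a * m - p\<^sup>2 * b"
  define B where "B = p * (c * (n + m) + p * d - p * a)"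
  have "of_int A + of_int B * s = (of_int p)\<^sup>2 *
      ((of_int n / of_int p + s) * (of_int c * (of_int m / of_int p + s) + of_int d)
      - (of_int a * (of_int m / of_int p + s) + of_int b))"
    using p by (simp add: A_def B_def s2 power2_eq_square field_simps)
  then have "of_int A + of_int B * s = 0" using eq by simp
  from linear_combination_irrational_zero[OF s this]
  have A: "n * c * m + n * d * p + p\<^sup>2 * c * int v - p * a * m - p\<^sup>2 * b = 0"
    and B: "p * a = c * (n + m) + p * d"
    using p by (auto simp: A_def B_def)
  have "p\<^sup>2 * (a * d - b * c) = p * d * (p * a) - c * (p\<^sup>2 * b)"
    by (simp add: power2_eq_square algebra_simps)
  also have "p\<^sup>2 * b = n * c * m + n * d * p + p\<^sup>2 * c * int v - (p * a) * m" using A by simp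
  finally have norm: "p\<^sup>2 * (a * d - b * c) = (p * d + c * m)\<^sup>2 - p\<^sup>2 * c\<^sup>2 * int v"
    unfolding B by (simp add: power2_eq_square algebra_simps)
  then have "(p * d + c * m)\<^sup>2 = p\<^sup>2 * (a * d - b * c + c\<^sup>2 * int v)" by (simp add: algebra_simps)
  then have "p\<^sup>2 dvd (p * d + c * m)\<^sup>2" by simp
  then have "p dvd p * d + c * m" by simp
  then have "p dvd c * m" by (simp add: dvd_add_right_iff)
  then have "p dvd c" using m by (simp add: p_def coprime_dvd_mult_left_iff coprime_commute)
  then obtain c' where c': "c = p * c'" by blast
  define r where "r = d + c' * m"
  have "p\<^sup>2 * (r\<^sup>2 - (p * c')\<^sup>2 * int v) = p\<^sup>2 * (a * d - b * c)"
    unfolding norm by (simp add: r_def c' power2_eq_square algebra_simps)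
  then have "r\<^sup>2 - (p * c')\<^sup>2 * int v \<in> {1, -1}" using det p by simp
  moreover have "p * (r * (n - m) - c' * m * n) = p * (p * (b - p * c' * int v))"
  proof -
    have "p * (p * b) = n * c * m + n * d * p + p\<^sup>2 * c * int v - (p * a) * m"
      using A by (simp add: power2_eq_square algebra_simps)
    then show ?thesis unfolding B by (simp add: r_def c' power2_eq_square algebra_simps)
  qed
  then have "p dvd r * (n - m) - c' * m * n" using p by simp
  ultimately show ?thesis using that unfolding p_def by blast
qed

text \<open>The matrix found in the other direction, with lower left entry \<open>q c\<close>. The congruence makes its
  entry \<open>b\<close> integral, and its determinant is the norm of \<open>r + q c sqrt v\<close>.\<close>

lemma pell_imp_unimodular:
  fixes m n r c :: int
  assumes q: "0 < q" and norm: "r\<^sup>2 - (int q * c)\<^sup>2 * int v \<in> {1, -1}"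
    and "int q dvd r * (n - m) - c * m * n"
  shows "unimodular_related (shifted_root v q m) (shifted_root v q n)"
proof -
  define s where "s = sqrt (of_nat v)"
  define p where "p = int q"
  have p: "p \<noteq> 0" using q by (simp add: p_def)
  have s2: "s * s = real v" by (simp add: s_def)
  obtain k where k: "r * (n - m) - c * m * n = p * k" using assms(3) unfolding p_def by blast
  define a b d where "a = r + c * n" and "b = p * c * int v + k" and "d = r - c * m"
  have "a * d - b * (p * c) = (r + c * n) * (r - c * m) - p * c * p * c * int v - c * (p * k)"
    by (simp add: a_def b_def d_def algebra_simps)
  also have "\<dots> = (r + c * n) * (r - c * m) - p * c * p * c * int v - c * (r * (n - m) - c * m * n)"
    by (simp only: k)
  also have "\<dots> = r\<^sup>2 - (p * c)\<^sup>2 * int v"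
    by (simp add: power2_eq_square algebra_simps)
  finally have det: "a * d - b * (p * c) \<in> {1, -1}" using norm by (simp add: p_def)
  have b: "of_int b = of_int p * of_int c * (s * s)
      + (of_int r * (of_int n - of_int m) - of_int c * of_int m * of_int n) / of_int p"
    using p arg_cong[OF k, of real_of_int] by (simp add: b_def s2 field_simps)
  have "(of_int n / of_int p + s) * (of_int (p * c) * (of_int m / of_int p + s) + of_int d)
      = of_int a * (of_int m / of_int p + s) + of_int b"
    unfolding b using p by (simp add: a_def d_def field_simps)
  then show ?thesis using det unfolding unimodular_related_def shifted_root_def p_def s_def
    by (metis of_int_of_nat_eq)
qed

section \<open>Residues of Pell solutions\<close>

text \<open>\<open>t\<close> represents the quotient \<open>c / r\<close> modulo \<open>q\<close> for a unit \<open>r + q c sqrt v\<close> of norm \<open>\<plusminus>1\<close>. Letting \<open>t\<close>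
  range over all integers makes the set of such \<open>t\<close> a subgroup of the integers, which therefore
  has a single generator.\<close>

definition pell_ratio :: "nat \<Rightarrow> nat \<Rightarrow> int \<Rightarrow> bool" where
  "pell_ratio v q t \<longleftrightarrow> (\<exists>r c :: int. r\<^sup>2 - (int q * c)\<^sup>2 * int v \<in> {1, -1} \<and> int q dvd c - t * r)"

lemma pell_ratio_multiple: "int q dvd t \<Longrightarrow> pell_ratio v q t"
  unfolding pell_ratio_def by (intro exI[of _ 1] exI[of _ 0]) simp

text \<open>Multiplying the units adds the quotients: modulo \<open>q\<close>, the product of \<open>r + q c sqrt v\<close> and
  \<open>r' + q c' sqrt v\<close> has the quotient \<open>(r c' + r' c) / (r r') = c / r + c' / r'\<close>.\<close>

lemma pell_ratio_add:
  assumes "pell_ratio v q s" "pell_ratio v q t"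
  shows "pell_ratio v q (s + t)"
proof -
  define p w where "p = int q" and "w = int v"
  obtain r c where rc: "r\<^sup>2 - (p * c)\<^sup>2 * w \<in> {1, -1}" "p dvd c - s * r"
    using assms(1) unfolding pell_ratio_def p_def w_def by blast
  obtain r' c' where rc': "r'\<^sup>2 - (p * c')\<^sup>2 * w \<in> {1, -1}" "p dvd c' - t * r'"
    using assms(2) unfolding pell_ratio_def p_def w_def by blast
  define R C where "R = r * r' + p\<^sup>2 * c * c' * w" and "C = r * c' + r' * c"
  have "R\<^sup>2 - (p * C)\<^sup>2 * w = (r\<^sup>2 - (p * c)\<^sup>2 * w) * (r'\<^sup>2 - (p * c')\<^sup>2 * w)"
    by (simp add: R_def C_def power2_eq_square algebra_simps)
  then have "R\<^sup>2 - (p * C)\<^sup>2 * w \<in> {1, -1}" using rc(1) rc'(1) by auto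
  moreover have "C - (s + t) * R
      = r' * (c - s * r) + r * (c' - t * r') - p * ((s + t) * p * c * c' * w)"
    by (simp add: R_def C_def power2_eq_square algebra_simps)
  then have "p dvd C - (s + t) * R" using rc(2) rc'(2) by simp
  ultimately show ?thesis unfolding pell_ratio_def p_def w_def by blast
qed

lemma pell_ratio_uminus:
  assumes "pell_ratio v q t"
  shows "pell_ratio v q (- t)"
proof -
  obtain r c where "r\<^sup>2 - (int q * c)\<^sup>2 * int v \<in> {1, -1}" "int q dvd c - t * r"
    using assms unfolding pell_ratio_def by blast
  moreover from this(2) have "int q dvd - c - (- t) * r"
    by (metis dvd_minus_iff minus_diff_eq minus_diff_minus mult_minus_left)
  ultimately show ?thesis unfolding pell_ratio_def
    by (intro exI[of _ r] exI[of _ "- c"]) simp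
qed

lemma pell_ratio_mult:
  assumes "pell_ratio v q t"
  shows "pell_ratio v q (k * t)"
proof -
  have nat_mult: "pell_ratio v q (int n * t)" for n
  proof (induction n)
    case (Suc n)
    then show ?case using pell_ratio_add[OF assms Suc.IH] by (simp add: algebra_simps)
  qed (simp add: pell_ratio_multiple)
  show ?thesis
  proof (cases "0 \<le> k")
    case True
    then show ?thesis using nat_mult[of "nat k"] by simp
  next
    case False
    then show ?thesis using pell_ratio_uminus[OF nat_mult[of "nat (- k)"]] by simp
  qed
qed

lemma pell_ratio_gcd:
  assumes "pell_ratio v q s" "pell_ratio v q t"
  shows "pell_ratio v q (gcd s t)"
proof -
  obtain a b where "a * s + b * t = gcd s t" using bezout_int by blast
  then show ?thesis using pell_ratio_add[OF pell_ratio_mult[OF assms(1)] pell_ratio_mult[OF assms(2)]]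
    by metis
qed

lemma norm_coprime:
  fixes r c p w :: int
  assumes "r\<^sup>2 - (p * c)\<^sup>2 * w \<in> {1, -1}"
  shows "coprime r p"
proof (rule coprimeI)
  fix g assume "g dvd r" "g dvd p"
  then have "g dvd r\<^sup>2 - (p * c)\<^sup>2 * w" by (simp add: power2_eq_square)
  then show "is_unit g" using assms by auto
qed

lemma coprime_inverse:
  fixes a p :: int
  assumes "coprime a p"
  obtains u where "p dvd u * a - 1" "coprime u p"
proof -
  obtain u where "[a * u = 1] (mod p)" using cong_solve_coprime_int assms by blast
  then have dvd: "p dvd u * a - 1" by (simp add: cong_iff_dvd_diff mult.commute)
  have "coprime u p"
  proof (rule coprimeI)
    fix g assume g: "g dvd u" "g dvd p"
    then have "g dvd u * a - (u * a - 1)" using dvd by (meson dvd_diff dvd_mult2 dvd_trans)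
    then show "is_unit g" by simp
  qed
  with dvd that show ?thesis by blast
qed

text \<open>The condition \<open>gcd(c, q\<^sup>2) = q d\<close> forces \<open>c = q c'\<close> with \<open>gcd(c', q) = d\<close>; since \<open>r\<close> is invertible
  modulo \<open>q\<close>, passing from \<open>c'\<close> to \<open>c' / r\<close> keeps this gcd.\<close>

lemma admissible_divisor_iff_pell_ratio:
  assumes "0 < q"
  shows "admissible_divisor v q d \<longleftrightarrow>
    0 < d \<and> d dvd q \<and> (\<exists>t. pell_ratio v q t \<and> gcd t (int q) = int d)"
proof -
  have scale: "gcd (int q * c) ((int q)\<^sup>2) = int q * gcd c (int q)" for c
    by (simp add: power2_eq_square gcd_mult_left)
  have "(\<exists>r c. r\<^sup>2 - c\<^sup>2 * int v \<in> {1, -1} \<and> gcd c ((int q)\<^sup>2) = int q * int d)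
      \<longleftrightarrow> (\<exists>t. pell_ratio v q t \<and> gcd t (int q) = int d)" (is "?L \<longleftrightarrow> ?R")
  proof
    assume ?L
    then obtain r c where norm: "r\<^sup>2 - c\<^sup>2 * int v \<in> {1, -1}"
      and gcd: "gcd c ((int q)\<^sup>2) = int q * int d" by blast
    have "int q dvd c" using gcd by (metis dvd_triv_left gcd_dvd1 dvd_trans)
    then obtain c' where c': "c = int q * c'" by blast
    have gcd': "gcd c' (int q) = int d" using gcd scale[of c'] assms by (simp add: c')
    have "coprime r (int q)" using norm_coprime norm unfolding c' by blast
    then obtain u where u: "int q dvd u * r - 1" "coprime u (int q)" using coprime_inverse by blast
    have "c' - (c' * u) * r = - c' * (u * r - 1)" by (simp add: algebra_simps)
    then have "int q dvd c' - (c' * u) * r" using u(1) by simp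
    then have "pell_ratio v q (c' * u)" using norm unfolding pell_ratio_def c' by blast
    moreover have "gcd (c' * u) (int q) = int d"
      using u(2) gcd' by (simp add: gcd_mult_left_right_cancel coprime_commute)
    ultimately show ?R by blast
  next
    assume ?R
    then obtain t r c where norm: "r\<^sup>2 - (int q * c)\<^sup>2 * int v \<in> {1, -1}"
      and c: "int q dvd c - t * r" and gcd: "gcd t (int q) = int d"
      unfolding pell_ratio_def by blast
    have "gcd c (int q) = gcd (t * r) (int q)"
      using c by (metis cong_iff_dvd_diff cong_gcd_eq)
    also have "\<dots> = int d"
      using norm_coprime[OF norm] gcd by (simp add: gcd_mult_left_right_cancel coprime_commute)
    finally have "gcd (int q * c) ((int q)\<^sup>2) = int q * int d" by (simp add: scale)
    then show ?L using norm by blast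
  qed
  then show ?thesis unfolding admissible_divisor_def by blast
qed

lemma least_divisor_admissible: "0 < q \<Longrightarrow> admissible_divisor v q (least_divisor v q)"
  unfolding least_divisor_def by (rule LeastI[OF admissible_divisor_self])

text \<open>The least admissible divisor generates the subgroup of Pell quotients. It belongs to it, because it
  is the gcd of some member and \<open>q\<close>; and its gcd with any member is again an admissible divisor,
  which by minimality cannot be smaller.\<close>

lemma pell_ratio_iff_least_divisor_dvd:
  assumes q: "0 < q"
  shows "pell_ratio v q t \<longleftrightarrow> int (least_divisor v q) dvd t"
proof -
  define d where "d = least_divisor v q"
  have adm: "admissible_divisor v q d"
    unfolding d_def by (rule least_divisor_admissible[OF q])
  then have d: "0 < d" "d dvd q" and "\<exists>t. pell_ratio v q t \<and> gcd t (int q) = int d"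
    by (auto simp: admissible_divisor_iff_pell_ratio[OF q])
  then have ratio_d: "pell_ratio v q (int d)"
    using pell_ratio_gcd pell_ratio_multiple dvd_refl by metis
  show ?thesis unfolding d_def[symmetric]
  proof
    assume "int d dvd t"
    then show "pell_ratio v q t" using pell_ratio_mult[OF ratio_d] by (metis dvdE mult.commute)
  next
    assume "pell_ratio v q t"
    define g where "g = nat (gcd t (int d))"
    have g: "int g = gcd t (int d)" by (simp add: g_def)
    have "pell_ratio v q (int g)"
      unfolding g by (rule pell_ratio_gcd[OF \<open>pell_ratio v q t\<close> ratio_d])
    moreover have "0 < g" using d(1) by (simp add: g_def)
    moreover have "g dvd d" using g by (metis gcd_dvd2 int_dvd_int_iff)
    moreover from this have "g dvd q" using d(2) by (rule dvd_trans)
    moreover from this have "gcd (int g) (int q) = int g" by (simp add: gcd_nat.absorb1)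
    ultimately have "admissible_divisor v q g"
      by (auto simp: admissible_divisor_iff_pell_ratio[OF q])
    then have "d \<le> g" unfolding d_def least_divisor_def by (rule Least_le)
    moreover have "g \<le> d" using \<open>g dvd d\<close> d(1) by (rule dvd_imp_le)
    ultimately have "int d = gcd t (int d)" using g by simp
    then show "int d dvd t" by (metis gcd_dvd1)
  qed
qed

text \<open>Dividing \<open>r (n - m) \<equiv> c m n\<close> by \<open>r m n\<close> modulo \<open>q\<close> turns it into \<open>1/m - 1/n \<equiv> c/r\<close>. Equivalence
  thus says that \<open>(n - m) / (m n)\<close> is a Pell quotient, that is, a multiple of the least admissible
  divisor, and the unit \<open>1 / (m n)\<close>, here \<open>u\<close>, does not affect this.\<close>

theorem cf_equiv_shifted_root_iff:
  assumes v: "\<nexists>k. v = k\<^sup>2" and q: "0 < q" and mn: "coprime m (int q)" "coprime n (int q)"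
  shows "(shifted_root v q m, shifted_root v q n) \<in> cf_equiv
    \<longleftrightarrow> m mod int (least_divisor v q) = n mod int (least_divisor v q)"
proof -
  define d where "d = int (least_divisor v q)"
  have "least_divisor v q dvd q"
    using least_divisor_admissible[OF q] by (simp add: admissible_divisor_def)
  then have dq: "d dvd int q" by (simp add: d_def)
  have "coprime (m * n) (int q)" using mn by simp
  then obtain u where u: "int q dvd u * (m * n) - 1" "coprime u (int q)"
    using coprime_inverse by blast
  have du: "coprime d u" using u(2) dq by (metis coprime_commute coprime_divisors dvd_refl)
  have "int q dvd c - u * (n - m) * r \<longleftrightarrow> int q dvd r * (n - m) - c * m * n" for r c
  proof
    have "r * (n - m) - c * m * n
        = - (m * n) * (c - u * (n - m) * r) - (r * (n - m)) * (u * (m * n) - 1)"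
      by (simp add: algebra_simps)
    then show "int q dvd r * (n - m) - c * m * n" if "int q dvd c - u * (n - m) * r"
      using that u(1) by (simp add: dvd_diff dvd_mult)
    have "c - u * (n - m) * r = - u * (r * (n - m) - c * m * n) - c * (u * (m * n) - 1)"
      by (simp add: algebra_simps)
    then show "int q dvd c - u * (n - m) * r" if "int q dvd r * (n - m) - c * m * n"
      using that u(1) by (simp add: dvd_diff dvd_mult)
  qed
  then have "unimodular_related (shifted_root v q m) (shifted_root v q n)
      \<longleftrightarrow> pell_ratio v q (u * (n - m))"
    unfolding pell_ratio_def
    using unimodular_imp_pell[OF v q mn(1)] pell_imp_unimodular[OF q] by metis
  also have "\<dots> \<longleftrightarrow> d dvd u * (n - m)"
    unfolding d_def by (rule pell_ratio_iff_least_divisor_dvd[OF q])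
  also have "\<dots> \<longleftrightarrow> d dvd n - m" using du by (simp add: coprime_dvd_mult_right_iff)
  also have "\<dots> \<longleftrightarrow> m mod d = n mod d" by (metis mod_eq_dvd_iff)
  finally show ?thesis
    using cf_equiv_iff_unimodular_related quadratic_irrational_shifted_root[OF q v]
    by (simp add: d_def)
qed

section \<open>Fibres of the reduction of unit groups\<close>

definition unit_residues :: "nat \<Rightarrow> int set" where
  "unit_residues n = {m. 0 \<le> m \<and> m < int n \<and> coprime m (int n)}"

lemma finite_unit_residues: "finite (unit_residues n)"
  by (rule finite_subset[of _ "{0..<int n}"]) (auto simp: unit_residues_def)

text \<open>Only for \<open>n = 1\<close> do the representatives \<open>{0..<n}\<close> here and \<open>{1..n}\<close> in \<^const>\<open>totatives\<close> give
  different sets.\<close>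

lemma card_unit_residues: "card (unit_residues n) = totient n"
proof (cases "n = 1")
  case True
  then have "unit_residues n = {0}" by (auto simp: unit_residues_def)
  then show ?thesis using True by simp
next
  case False
  have "unit_residues n = int ` totatives n"
  proof (intro Set.set_eqI iffI)
    fix m assume "m \<in> unit_residues n"
    then have m: "0 \<le> m" "m < int n" "coprime m (int n)" by (auto simp: unit_residues_def)
    then have "m \<noteq> 0" using False by auto
    moreover have "coprime (nat m) n" using m(1,3) by (metis coprime_int_iff int_nat_eq)
    ultimately have "nat m \<in> totatives n" using m by (auto simp: in_totatives_iff)
    then show "m \<in> int ` totatives n" using m(1) by force
  next
    fix m assume "m \<in> int ` totatives n"
    then obtain k where "m = int k" "k \<in> totatives n" by blast
    moreover from this have "k < n"
      using False by (cases "n = 0") (auto intro: totatives_less)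
    ultimately show "m \<in> unit_residues n" by (auto simp: unit_residues_def in_totatives_iff)
  qed
  then show ?thesis by (simp add: card_image totient_def)
qed

text \<open>Take \<open>m = u + d k\<close>, where \<open>k\<close> is the product of the primes that divide \<open>n\<close> but not \<open>u\<close>. Every
  prime divisor of \<open>n\<close> divides exactly one of the summands \<open>u\<close> and \<open>d k\<close>, hence not their sum.\<close>

lemma coprime_lift:
  fixes u d :: int and n :: nat
  assumes "coprime u d" "0 < n"
  obtains m where "m mod d = u mod d" "coprime m (int n)"
proof
  define k where "k = (\<Prod>p | prime p \<and> p dvd int n \<and> \<not> p dvd u. p)"
  have fin: "finite {p. prime p \<and> p dvd int n \<and> \<not> p dvd u}"
    by (rule finite_subset[of _ "{0..int n}"]) (use assms(2) zdvd_imp_le prime_ge_0_int in auto)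
  show "(u + d * k) mod d = u mod d" by simp
  show "coprime (u + d * k) (int n)"
  proof (rule ccontr)
    assume "\<not> coprime (u + d * k) (int n)"
    then have "\<not> is_unit (gcd (u + d * k) (int n))"
      by (simp add: coprime_iff_gcd_eq_1)
    moreover have "gcd (u + d * k) (int n) \<noteq> 0" using assms(2) by simp
    ultimately obtain p where p: "prime p" "p dvd gcd (u + d * k) (int n)"
      using prime_divisor_exists by blast
    then have dvd: "p dvd u + d * k" "p dvd int n" by auto
    show False
    proof (cases "p dvd u")
      case True
      have "\<not> p dvd d" using assms(1) True p(1) by (meson coprime_common_divisor not_prime_unit)
      moreover have "\<not> p dvd k"
      proof
        assume "p dvd k"
        then obtain r where "prime r" "\<not> r dvd u" "p dvd r"
          using fin p(1) unfolding k_def by (auto simp: prime_dvd_prod_iff)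
        then show False using True p(1) primes_dvd_imp_eq by blast
      qed
      ultimately have "\<not> p dvd d * k" using p(1) by (simp add: prime_dvd_mult_iff)
      then show False using dvd(1) True by (simp add: dvd_add_right_iff)
    next
      case False
      then have "p dvd k" unfolding k_def
        using fin p(1) dvd(2) by (intro dvd_prodI) auto
      then have "p dvd u" using dvd(1) by (simp add: dvd_add_left_iff)
      then show False using False by contradiction
    qed
  qed
qed

lemma mod_image_unit_residues:
  assumes "d dvd n" "0 < n"
  shows "(\<lambda>m. m mod int d) ` unit_residues n = unit_residues d"
proof (intro Set.set_eqI iffI)
  have d: "0 < d" using assms by (auto intro: dvd_pos_nat)
  have dn: "int d dvd int n" using assms(1) by simp
  fix u
  {
    assume "u \<in> (\<lambda>m. m mod int d) ` unit_residues n"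
    then obtain m where m: "u = m mod int d" "coprime m (int n)" by (auto simp: unit_residues_def)
    then have "coprime m (int d)" using dn by (metis coprime_divisors dvd_refl)
    then show "u \<in> unit_residues d" using m(1) d by (simp add: unit_residues_def)
  next
    assume u: "u \<in> unit_residues d"
    then have "coprime u (int d)" "u mod int d = u" by (auto simp: unit_residues_def)
    then obtain m where m: "m mod int d = u" "coprime m (int n)"
      using coprime_lift assms(2) by metis
    have "m mod int n \<in> unit_residues n" using m(2) assms(2) by (simp add: unit_residues_def)
    moreover have "(m mod int n) mod int d = u" using m(1) dn by (simp add: mod_mod_cancel)
    ultimately show "u \<in> (\<lambda>m. m mod int d) ` unit_residues n" by force
  }
qed

definition residue_fibre :: "nat \<Rightarrow> nat \<Rightarrow> int \<Rightarrow> int set" where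
  "residue_fibre n d a = {m \<in> unit_residues n. m mod int d = a mod int d}"

text \<open>Multiplication by \<open>b / a\<close> modulo \<open>n\<close> maps the fibre of \<open>a\<close> injectively into the fibre of \<open>b\<close>.\<close>

lemma card_residue_fibre_le:
  assumes "d dvd n" "0 < n" and a: "a \<in> unit_residues n" and b: "b \<in> unit_residues n"
  shows "card (residue_fibre n d a) \<le> card (residue_fibre n d b)"
proof -
  define N where "N = int n"
  have dN: "int d dvd N" using assms(1) by (simp add: N_def)
  obtain w where w: "N dvd w * a - 1" "coprime w N"
    using a coprime_inverse by (auto simp: unit_residues_def N_def)
  define h where "h m = (m * (w * b)) mod N" for m
  have wb: "coprime (w * b) N" using w(2) b by (simp add: unit_residues_def N_def)
  have "inj_on h (residue_fibre n d a)"
  proof (rule inj_onI)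
    fix m m' assume m: "m \<in> residue_fibre n d a" "m' \<in> residue_fibre n d a" and "h m = h m'"
    then have "[m * (w * b) = m' * (w * b)] (mod N)" by (simp add: h_def cong_def)
    then have "[m = m'] (mod N)" using wb cong_mult_rcancel by blast
    then show "m = m'" using m by (auto simp: residue_fibre_def unit_residues_def cong_def N_def)
  qed
  moreover have "h ` residue_fibre n d a \<subseteq> residue_fibre n d b"
  proof
    fix y assume "y \<in> h ` residue_fibre n d a"
    then obtain m where y: "y = h m" and m: "coprime m N" "m mod int d = a mod int d"
      by (auto simp: residue_fibre_def unit_residues_def N_def)
    have "y \<in> unit_residues n"
      using m(1) wb assms(2) by (simp add: unit_residues_def y h_def N_def)
    moreover have "int d dvd h m - b"
    proof -
      have "int d dvd h m - m * (w * b)"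
        using dN by (metis h_def dvd_trans mod_eq_dvd_iff mod_mod_trivial)
      moreover have "int d dvd (m - a) * (w * b)" using m(2) by (simp add: mod_eq_dvd_iff)
      moreover have "int d dvd (w * a - 1) * b" using w(1) dN by (meson dvd_mult2 dvd_trans)
      \<comment> \<open>Reduce modulo \<open>n\<close>, replace \<open>m\<close> by \<open>a\<close>, and cancel \<open>w a\<close>: each step is a congruence modulo \<open>d\<close>.\<close>
      moreover have "h m - b = (h m - m * (w * b)) + (m - a) * (w * b) + (w * a - 1) * b"
        by (simp add: algebra_simps)
      ultimately show ?thesis by (metis dvd_add)
    qed
    ultimately show "y \<in> residue_fibre n d b"
      by (simp add: residue_fibre_def y mod_eq_dvd_iff)
  qed
  moreover have "finite (residue_fibre n d b)"
    using finite_unit_residues by (simp add: residue_fibre_def)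
  ultimately show ?thesis using card_inj_on_le by blast
qed

lemma card_residue_fibre:
  assumes "d dvd n" "0 < n" and a: "a \<in> unit_residues n"
  shows "totient d * card (residue_fibre n d a) = totient n"
proof -
  let ?g = "\<lambda>m. m mod int d"
  have "card (unit_residues n)
      = (\<Sum>y \<in> ?g ` unit_residues n. card {m \<in> unit_residues n. ?g m = y})"
    using sum.image_gen[OF finite_unit_residues, of "\<lambda>_. 1::nat" n ?g] by simp
  also have "\<dots> = (\<Sum>y \<in> ?g ` unit_residues n. card (residue_fibre n d a))"
  proof (rule sum.cong)
    fix y assume "y \<in> ?g ` unit_residues n"
    then obtain b where b: "b \<in> unit_residues n" "y = b mod int d" by blast
    have "card (residue_fibre n d b) = card (residue_fibre n d a)"
      using card_residue_fibre_le[OF assms(1,2)] a b(1) by (intro antisym)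
    then show "card {m \<in> unit_residues n. ?g m = y} = card (residue_fibre n d a)"
      by (simp add: residue_fibre_def b(2))
  qed simp
  also have "\<dots> = totient d * card (residue_fibre n d a)"
    by (simp add: mod_image_unit_residues[OF assms(1,2)] card_unit_residues)
  finally show ?thesis by (simp add: card_unit_residues)
qed

section \<open>Counting the equivalence classes\<close>

lemma card_image_same_kernel:
  assumes "\<And>x y. x \<in> A \<Longrightarrow> y \<in> A \<Longrightarrow> f x = f y \<longleftrightarrow> g x = g y"
  shows "card (f ` A) = card (g ` A)"
proof (rule bij_betw_same_card)
  show "bij_betw (\<lambda>y. g (inv_into A f y)) (f ` A) (g ` A)"
    unfolding bij_betw_def
  proof
    show "inj_on (\<lambda>y. g (inv_into A f y)) (f ` A)"
      by (rule inj_onI) (metis assms f_inv_into_f inv_into_into)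
    have "g (inv_into A f (f x)) = g x" if "x \<in> A" for x
      using that by (intro iffD1[OF assms] inv_into_into f_inv_into_f) auto
    then show "(\<lambda>y. g (inv_into A f y)) ` f ` A = g ` A" by (simp add: image_image)
  qed
qed

lemma cf_equiv_class_eq_iff:
  assumes "quadratic_irrational y"
  shows "cf_equiv `` {x} = cf_equiv `` {y} \<longleftrightarrow> (x, y) \<in> cf_equiv"
proof
  have "(y, y) \<in> cf_equiv"
    using assms by (auto simp: cf_equiv_iff_same_tail same_tail_def)
  then show "(x, y) \<in> cf_equiv" if "cf_equiv `` {x} = cf_equiv `` {y}" using that by blast
next
  assume "(x, y) \<in> cf_equiv"
  then have xy: "quadratic_irrational x" "quadratic_irrational y" "same_tail x y"
    unfolding cf_equiv_iff_same_tail by iprover+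
  then have "same_tail x z \<longleftrightarrow> same_tail y z" for z
    using same_tail_trans[OF xy(3), of z] same_tail_trans[OF same_tail_sym[OF xy(3)], of z] by blast
  then have "(x, z) \<in> cf_equiv \<longleftrightarrow> (y, z) \<in> cf_equiv" for z
    by (simp only: cf_equiv_iff_same_tail xy(1,2))
  then show "cf_equiv `` {x} = cf_equiv `` {y}" by (simp only: Image_singleton)
qed

lemma shifted_roots_eq: "shifted_roots v q = shifted_root v q ` unit_residues q"
proof -
  have "gcd m (int q) = 1 \<and> 0 \<le> m \<and> m \<le> int q - 1 \<longleftrightarrow> m \<in> unit_residues q" for m
    unfolding unit_residues_def coprime_iff_gcd_eq_1 mem_Collect_eq by linarith
  then show ?thesis
    by (simp only: shifted_roots_def shifted_root_def[symmetric] setcompr_eq_image Collect_mem_eq)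
qed

theorem theorem2:
  fixes v q :: nat
  assumes "0 < v" and "0 < q" and "\<nexists>k. v = k\<^sup>2"
  shows "card (shifted_roots v q // cf_equiv) = totient (least_divisor v q) \<and>
    (\<forall>C \<in> shifted_roots v q // cf_equiv.
       real (card (C \<inter> shifted_roots v q)) =
         real (totient q) / real (totient (least_divisor v q)))"
proof -
  define d where "d = least_divisor v q"
  have d: "0 < d" "d dvd q"
    using least_divisor_admissible[OF assms(2)] by (auto simp: d_def admissible_divisor_def)
  define cls where "cls m = cf_equiv `` {shifted_root v q m}" for m
  have quotient: "shifted_roots v q // cf_equiv = cls ` unit_residues q"
    by (auto simp: quotient_def shifted_roots_eq cls_def)
  have equiv_iff: "(shifted_root v q m, shifted_root v q n) \<in> cf_equiv \<longleftrightarrow> m mod int d = n mod int d"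
    if "m \<in> unit_residues q" "n \<in> unit_residues q" for m n
    using that cf_equiv_shifted_root_iff[OF assms(3,2)] by (simp add: unit_residues_def d_def)
  have "card (cls ` unit_residues q) = card ((\<lambda>m. m mod int d) ` unit_residues q)"
    by (rule card_image_same_kernel)
      (simp add: cls_def cf_equiv_class_eq_iff equiv_iff quadratic_irrational_shifted_root assms)
  then have "card (shifted_roots v q // cf_equiv) = totient d"
    by (simp add: quotient mod_image_unit_residues[OF d(2) assms(2)] card_unit_residues)
  moreover have "real (card (C \<inter> shifted_roots v q)) = real (totient q) / real (totient d)"
    if C: "C \<in> shifted_roots v q // cf_equiv" for C
  proof -
    obtain a where a: "a \<in> unit_residues q" "C = cls a" using C unfolding quotient by blast
    have "C \<inter> shifted_roots v q = shifted_root v q ` residue_fibre q d a"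
      unfolding a(2) cls_def shifted_roots_eq residue_fibre_def using equiv_iff[OF a(1)] by fastforce
    moreover have "inj (shifted_root v q)"
      using assms(2) by (auto simp: inj_def shifted_root_def)
    ultimately have "card (C \<inter> shifted_roots v q) = card (residue_fibre q d a)"
      by (simp add: card_image inj_on_subset)
    moreover have "real (totient d) * real (card (residue_fibre q d a)) = real (totient q)"
      using card_residue_fibre[OF d(2) assms(2) a(1)] by (metis of_nat_mult)
    moreover have "0 < totient d" using d(1) by simp
    ultimately show ?thesis by (simp add: field_simps)
  qed
  ultimately show ?thesis by (simp add: d_def)
qed

end
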